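(* Let $n\ge 0$ be an integer. The polynomial $$A_n(z)=\sum_{k=0}^n \binom{n}{k}\,(n+k)!\,z^{n-k}$$ is a Hurwitz polynomial. Moreover, for the function $f_n(t)=t^n e^{-t}\mathbf{1}_{(0,\infty)}(t)$ on $\mathbb{R}$, the ambiguity function $A(f_n,f_n)$ does not have any zeros, i.e. $A(f_n,f_n)(x,\xi)\neq 0$ for all $(x,\xi)\in\mathbb{R}^2$.
   Context: A Hurwitz polynomial is a polynomial all of whose (complex) roots have strictly negative real part. The ambiguity function of $f,g\in L^2(\mathbb{R})$ is $$A(f,g)(x,\xi)=\int_{\mathbb{R}} f\left(t+\tfrac{x}{2}\right)\overline{g\left(t-\tfrac{x}{2}\right)}\,e^{-2\pi i\xi t}\,dt,\qquad (x,\xi)\in\mathbb{R}^2.$$ $\mathbf{1}_E$ denotes the indicator function of a set $E$. *)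

theory Defs
  imports "HOL-Analysis.Analysis" "HOL-Computational_Algebra.Polynomial"
begin

(* Nonzero constants satisfy this vacuously; the zero polynomial does not. *)
definition hurwitz_polynomial :: "complex poly \<Rightarrow> bool" where
  "hurwitz_polynomial p \<longleftrightarrow> (\<forall>z. poly p z = 0 \<longrightarrow> Re z < 0)"

definition A_poly :: "nat \<Rightarrow> complex poly" where
  "A_poly n = (\<Sum>k=0..n. monom (of_nat ((n choose k) * fact (n + k))) (n - k))"

(* Meant for square-integrable f and g, for which the integrand is always integrable.
   For other arguments the Bochner integral may take its default value 0. *)
definition ambiguity ::
    "(real \<Rightarrow> complex) \<Rightarrow> (real \<Rightarrow> complex) \<Rightarrow> real \<times> real \<Rightarrow> complex" where
  "ambiguity f g = (\<lambda>(x, \<xi>).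
     (LINT t|lebesgue. f (t + x / 2) * cnj (g (t - x / 2)) *
        exp (- 2 * of_real pi * \<i> * of_real \<xi> * of_real t)))"

definition f_fun :: "nat \<Rightarrow> real \<Rightarrow> complex" where
  "f_fun n t = of_real (t ^ n * exp (- t) * indicator {0<..} t)"

end

theory Submission
  imports Defs "HOL-Real_Asymp.Real_Asymp"
begin

text \<open>
  Write \<open>A n\<close> for the polynomial \<open>A_poly n\<close>. Both claims come down to the fact that it has no
  zero in the closed right half plane.

  Up to scaling, the \<open>A n\<close> are the reverse Bessel polynomials, and they satisfy a three-term
  recurrence (\<open>A_poly_recurrence\<close>) expressing \<open>A (n + 2)\<close> as \<open>c * A (n + 1) + d * z\<^sup>2 * A n\<close>
  with positive \<open>c\<close> and \<open>d\<close>. For the ratios \<open>r n = A (n + 1) / (z * A n)\<close> it reads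
  \<open>r (n + 1) = c / z + d / r n\<close>, a continued fraction. Inversion preserves the right half
  plane, so if \<open>0 \<le> Re z\<close> and \<open>z \<noteq> 0\<close>, then all \<open>r n\<close> have positive real part, starting
  from \<open>r 0 = 1 + 2 / z\<close> (\<open>A_poly_ratio_Re_pos\<close>). Hence no \<open>A n\<close> vanishes at such a \<open>z\<close>; and at
  the origin the value is \<open>(2 * n)!\<close>.

  For the ambiguity function, the product of the two translates of \<open>f_fun n\<close> is supported on the
  half-line \<open>t > \<bar>x\<bar> / 2\<close>. Moving the origin to the end of that half-line turns the integral
  into the Laplace transform of \<open>(s * (s + \<bar>x\<bar>)) ^ n\<close> at \<open>w = 2 + 2 * pi * \<i> * \<xi>\<close>, times an
  exponential. The binomial theorem and the Laplace transforms \<open>m! / w ^ (m + 1)\<close> of the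
  monomials \<open>s ^ m\<close> evaluate that transform as the value of \<open>A n\<close> at
  \<open>\<bar>x\<bar> * w\<close> divided by \<open>w ^ (2 * n + 1)\<close> (\<open>ambiguity_f_fun\<close>).
  Since \<open>\<bar>x\<bar> * w\<close> has real part \<open>2 * \<bar>x\<bar> \<ge> 0\<close>, this does not vanish.
\<close>

section \<open>Roots of the polynomials\<close>

lemma poly_A_poly:
  "poly (A_poly n) z = (\<Sum>k\<le>n. of_nat ((n choose k) * fact (n + k)) * z ^ (n - k))"
  by (simp add: A_poly_def poly_sum poly_monom atLeast0AtMost)

text \<open>
  The recurrence for the coefficients. Absorption turns each binomial coefficient on the right
  into a multiple of \<open>C = (n + 2) choose (k + 1)\<close>. With \<open>j = k + 1\<close>, what remains is
  \<open>(n + j + 2) * (n + j + 1) = (4 * n + 6) * j + (n + 2 - j) * (n + 1 - j)\<close>.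
\<close>
lemma binomial_fact_recurrence:
  "(Suc (Suc n) choose Suc k) * fact (n + Suc k + 2) =
     (n + 2) * (4 * n + 6) * ((Suc n choose k) * fact (Suc n + k))
     + (n + 2) * (n + 1) * ((n choose Suc k) * fact (n + Suc k))"
proof -
  \<comment> \<open>In the integers the absorption identities also hold beyond the diagonal, where the factors
    \<open>n + 1 - k\<close> and \<open>n - k\<close> may be negative.\<close>
  let ?c = "int (Suc (Suc n) choose Suc k)"
  have absorb_lower: "int (n + 2) * int (Suc n choose k) = int (k + 1) * ?c"
    unfolding of_nat_mult[symmetric] of_nat_eq_iff
    using Suc_times_binomial[of k "Suc n"] by (simp del: binomial_Suc_Suc)
  have absorb_upper:
    "int (n + 2) * int (n + 1) * int (n choose Suc k) = (int n + 1 - int k) * (int n - int k) * ?c"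
  proof (cases "k \<le> n")
    case True
    have "int (Suc n - k) * ?c = int (n + 2) * int (Suc n choose Suc k)"
      unfolding of_nat_mult[symmetric] of_nat_eq_iff
      using binomial_absorb_comp[of "Suc (Suc n)" "Suc k"] by (simp del: binomial_Suc_Suc)
    moreover have "int (n - k) * int (Suc n choose Suc k) = int (n + 1) * int (n choose Suc k)"
      unfolding of_nat_mult[symmetric] of_nat_eq_iff
      using binomial_absorb_comp[of "Suc n" "Suc k"] by (simp del: binomial_Suc_Suc)
    ultimately show ?thesis
      using True by (simp del: binomial_Suc_Suc) algebra
  next
    case False
    then have "n < k" by simp
    then show ?thesis by (cases "k = Suc n") (auto simp: binomial_eq_0)
  qed
  let ?F = "int (fact (Suc n + k))"
  have "int ((Suc (Suc n) choose Suc k) * fact (n + Suc k + 2))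
        = ?c * (int n + int k + 3) * (int n + int k + 2) * ?F"
    by (simp add: algebra_simps)
  also have "\<dots> = (int (4 * n + 6) * (int (k + 1) * ?c)
        + (int n + 1 - int k) * (int n - int k) * ?c) * ?F"
    by (simp add: algebra_simps)
  also have "\<dots> = int ((n + 2) * (4 * n + 6) * ((Suc n choose k) * fact (Suc n + k))
     + (n + 2) * (n + 1) * ((n choose Suc k) * fact (n + Suc k)))"
    unfolding absorb_lower[symmetric] absorb_upper[symmetric] by (simp add: algebra_simps)
  finally show ?thesis by linarith
qed

lemma A_poly_recurrence:
  "poly (A_poly (n + 2)) z = of_nat ((n + 2) * (4 * n + 6)) * poly (A_poly (n + 1)) z
     + of_nat ((n + 2) * (n + 1)) * z\<^sup>2 * poly (A_poly n) z"
proof -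
  define a where "a n k = (of_nat ((n choose k) * fact (n + k)) :: complex)" for n k
  have A: "poly (A_poly n) z = (\<Sum>k\<le>n. a n k * z ^ (n - k))" for n
    by (simp only: poly_A_poly a_def)
  have a_rec: "a (n + 2) (Suc k) = of_nat ((n + 2) * (4 * n + 6)) * a (n + 1) k
      + of_nat ((n + 2) * (n + 1)) * a n (Suc k)" for k
    unfolding a_def of_nat_mult[symmetric] of_nat_add[symmetric]
    using binomial_fact_recurrence[of n k] by (intro arg_cong[where f = of_nat]) (simp add: ac_simps)
  have a_0: "a (n + 2) 0 = of_nat ((n + 2) * (n + 1)) * a n 0"
    by (simp add: a_def algebra_simps)
  have lower: "z\<^sup>2 * poly (A_poly n) z
      = a n 0 * z ^ (n + 2) + (\<Sum>k\<le>n + 1. a n (Suc k) * z ^ (n + 1 - k))"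
  proof -
    have "z\<^sup>2 * poly (A_poly n) z = (\<Sum>k\<le>n. a n k * z ^ (n + 2 - k))"
      unfolding A sum_distrib_left
      by (intro sum.cong) (auto simp: Suc_diff_le power2_eq_square)
    \<comment> \<open>The two additional coefficients are 0, and all three sums get the same range.\<close>
    also have "\<dots> = (\<Sum>k\<le>Suc (n + 1). a n k * z ^ (n + 2 - k))"
      by (intro sum.mono_neutral_left) (auto simp: a_def binomial_eq_0)
    also have "\<dots> = a n 0 * z ^ (n + 2) + (\<Sum>k\<le>n + 1. a n (Suc k) * z ^ (n + 1 - k))"
      unfolding sum.atMost_Suc_shift by simp
    finally show ?thesis .
  qed
  have "poly (A_poly (n + 2)) z = (\<Sum>k\<le>Suc (n + 1). a (n + 2) k * z ^ (n + 2 - k))"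
    unfolding A by simp
  also have "\<dots> = a (n + 2) 0 * z ^ (n + 2)
      + (\<Sum>k\<le>n + 1. a (n + 2) (Suc k) * z ^ (n + 1 - k))"
    unfolding sum.atMost_Suc_shift by simp
  also have "\<dots> = of_nat ((n + 2) * (4 * n + 6)) * (\<Sum>k\<le>n + 1. a (n + 1) k * z ^ (n + 1 - k))
      + of_nat ((n + 2) * (n + 1)) * (a n 0 * z ^ (n + 2)
          + (\<Sum>k\<le>n + 1. a n (Suc k) * z ^ (n + 1 - k)))"
    unfolding a_rec a_0
    by (simp add: distrib_right distrib_left sum.distrib sum_distrib_left mult.assoc
        del: sum.atMost_Suc of_nat_mult)
  finally show ?thesis
    unfolding lower[symmetric] A[of "n + 1", symmetric] by (simp add: mult.assoc)
qed

lemma Re_inverse_nonneg_iff: "0 \<le> Re (inverse w) \<longleftrightarrow> 0 \<le> Re w"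
  by (auto simp: zero_le_divide_iff sum_power2_le_zero_iff)

lemma Re_inverse_pos: "0 < Re w \<Longrightarrow> 0 < Re (inverse w)"
  by (auto simp: sum_power2_gt_zero_iff)

text \<open>
  By the recurrence, each ratio is \<open>c * inverse z + d * inverse r\<close> with \<open>r\<close> the previous one and
  \<open>c\<close>, \<open>d\<close> positive, and inversion preserves the right half plane. A positive real part of one
  ratio also shows that its numerator, the denominator of the next one, does not vanish. Excluding \<open>z = 0\<close> makes the imaginary axis work too: there \<open>inverse z\<close> contributes
  nothing to the real part, which then comes from the previous ratio alone.
\<close>
lemma A_poly_ratio_Re_pos:
  assumes "0 \<le> Re z" "z \<noteq> 0"
  shows "poly (A_poly n) z \<noteq> 0 \<and>
    0 < Re (poly (A_poly (n + 1)) z / (z * poly (A_poly n) z))"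
proof (induction n)
  case 0
  have "poly (A_poly 1) z / z = 1 + 2 * inverse z"
    using assms by (simp add: poly_A_poly field_simps)
  then show ?case
    using assms by (simp add: poly_A_poly add_pos_nonneg)
next
  case (Suc n)
  define r where "r = poly (A_poly (n + 1)) z / (z * poly (A_poly n) z)"
  have nz: "poly (A_poly (n + 1)) z \<noteq> 0"
    using Suc by auto
  have r_pos: "0 < Re r"
    using Suc by (simp add: r_def)
  define c d where "c = real ((n + 2) * (4 * n + 6))" and "d = real ((n + 2) * (n + 1))"
  have rec: "poly (A_poly (n + 2)) z
      = of_real c * poly (A_poly (n + 1)) z + of_real d * z\<^sup>2 * poly (A_poly n) z"
    unfolding A_poly_recurrence c_def d_def of_real_of_nat_eq ..
  have "poly (A_poly (n + 2)) z / (z * poly (A_poly (n + 1)) z)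
      = of_real c * inverse z + of_real d * inverse r"
    unfolding rec r_def using nz assms(2)
    by (simp add: field_simps power2_eq_square)
  then have "Re (poly (A_poly (n + 2)) z / (z * poly (A_poly (n + 1)) z))
      = c * Re (inverse z) + d * Re (inverse r)"
    by (simp del: complex_inverse)
  also have "\<dots> > 0"
  proof -
    have "c \<ge> 0" "d > 0"
      unfolding c_def d_def by (simp_all only: of_nat_0_le_iff of_nat_0_less_iff) simp
    then show ?thesis
      using assms Re_inverse_nonneg_iff Re_inverse_pos[OF r_pos]
      by (intro add_nonneg_pos mult_nonneg_nonneg mult_pos_pos) blast+
  qed
  finally show ?case
    using nz by simp
qed

lemma A_poly_nonzero:
  assumes "0 \<le> Re z"
  shows "poly (A_poly n) z \<noteq> 0"
proof (cases "z = 0")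
  case True
  have "poly (A_poly n) 0 = (\<Sum>k\<in>{n}. of_nat ((n choose k) * fact (n + k)) * 0 ^ (n - k))"
    unfolding poly_A_poly by (intro sum.mono_neutral_right) auto
  then show ?thesis
    using True by simp
qed (use A_poly_ratio_Re_pos assms in blast)

section \<open>Laplace transforms of monomials\<close>

text \<open>
  The integrand has the absolute value of Euler's integrand for \<open>Gamma (m + 1)\<close> with decay rate
  \<open>Re w\<close>.
\<close>
lemma integrable_power_exp:
  fixes w :: complex
  assumes "0 < Re w"
  shows "set_integrable lborel {0<..} (\<lambda>s. of_real s ^ m * exp (- w * of_real s))"
proof -
  have "(\<lambda>s. complex_of_real s powr (of_nat (Suc m) - 1) / of_real (exp (Re w * s)))
      absolutely_integrable_on {0<..}"
    by (rule absolutely_integrable_Gamma_integral) (use assms in auto)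
  then have "set_integrable lebesgue {0<..}
      (\<lambda>s. complex_of_real s powr (of_nat (Suc m) - 1) / of_real (exp (Re w * s)))" .
  then have "set_integrable lebesgue {0<..} (\<lambda>s. of_real s ^ m * exp (- w * of_real s))"
    unfolding set_integrable_def
  proof (rule Bochner_Integration.integrable_bound)
    have "(\<lambda>s. indicator {0<..} s *\<^sub>R (of_real s ^ m * exp (- w * of_real s))) \<in> borel_measurable lborel"
      by measurable
    then show "(\<lambda>s. indicator {0<..} s *\<^sub>R (of_real s ^ m * exp (- w * of_real s))) \<in> borel_measurable lebesgue"
      by (rule measurable_completion)
    show "AE s in lebesgue. norm (indicator {0<..} s *\<^sub>R (of_real s ^ m * exp (- w * of_real s)))
        \<le> norm (indicator {0<..} s *\<^sub>R (complex_of_real s powr (of_nat (Suc m) - 1) / of_real (exp (Re w * s))))"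
      by (intro AE_I2) (auto simp: indicator_def norm_mult norm_divide norm_power exp_minus field_simps
          powr_nat')
  qed
  then show ?thesis
    unfolding set_integrable_def by (subst (asm) integrable_completion) measurable
qed

text \<open>
  The integrand is the derivative of \<open>s ^ m * exp (- w * s)\<close>, which tends to 0 at infinity. At
  the origin its value is \<open>0 ^ m\<close>, that is, 1 for \<open>m = 0\<close> and 0 otherwise; so this single
  identity yields both the base case and the induction step for the Laplace transform of
  \<open>s ^ m\<close>.
\<close>
lemma integral_deriv_power_exp:
  fixes w :: complex
  assumes w: "0 < Re w"
  shows "(LINT s:{0<..}|lborel. of_nat m * (of_real s ^ (m - 1) * exp (- w * of_real s))
      - w * (of_real s ^ m * exp (- w * of_real s))) = - (0 ^ m)"
proof -
  define F where "F s = of_real s ^ m * exp (- w * of_real s)" for s :: real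
  define f where "f s = of_nat m * (of_real s ^ (m - 1) * exp (- w * of_real s)) - w * F s" for s :: real
  have F_deriv: "(F has_vector_derivative f s) (at s)" for s
    unfolding F_def f_def
    by (auto intro!: derivative_eq_intros has_vector_derivative_real_field simp: algebra_simps)
  have "set_integrable lborel {0<..} f"
    unfolding f_def F_def
    by (intro set_integral_diff set_integrable_mult_right integrable_power_exp w)
  moreover have "isCont f s" for s
    unfolding f_def F_def by (intro continuous_intros)
  moreover have "(F \<longlongrightarrow> 0) at_top"
  proof (rule tendsto_norm_zero_cancel)
    have "((\<lambda>s. s ^ m * exp (- Re w * s)) \<longlongrightarrow> 0) at_top"
      using w by real_asymp
    moreover have "\<forall>\<^sub>F s in at_top. s ^ m * exp (- Re w * s) = norm (F s)"
      using eventually_ge_at_top[of 0] by eventually_elim (simp add: F_def norm_mult norm_power)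
    ultimately show "((\<lambda>s. norm (F s)) \<longlongrightarrow> 0) at_top"
      by (rule Lim_transform_eventually)
  qed
  moreover have "(F \<longlongrightarrow> 0 ^ m) (at_right 0)"
  proof -
    have "isCont F 0"
      unfolding F_def by (intro continuous_intros)
    then have "(F \<longlongrightarrow> F 0) (at_right 0)"
      by (simp add: isCont_def filterlim_at_split)
    then show ?thesis by (simp add: F_def)
  qed
  ultimately have "(LBINT s=ereal 0..\<infinity>. f s) = 0 - 0 ^ m"
    using F_deriv
    by (intro interval_integral_FTC_integrable[where F = F]) (auto simp: ereal_tendsto_simps zero_ereal_def)
  then show ?thesis
    unfolding interval_integral_to_infinity_eq f_def F_def by simp
qed

lemma laplace_transform_power:
  fixes w :: complex
  assumes w: "0 < Re w"
  shows "(LINT s:{0<..}|lborel. of_real s ^ m * exp (- w * of_real s)) = fact m / w ^ Suc m"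
proof (induction m)
  case 0
  have "- w * (LINT s:{0<..}|lborel. of_real s ^ 0 * exp (- w * of_real s))
      = (LINT s:{0<..}|lborel. - w * (of_real s ^ 0 * exp (- w * of_real s)))"
    by (rule set_integral_mult_right[symmetric])
  also have "\<dots> = - 1"
    using integral_deriv_power_exp[OF w, of 0] by simp
  finally have "w * (LINT s:{0<..}|lborel. of_real s ^ 0 * exp (- w * of_real s)) = 1"
    by simp
  moreover have "w \<noteq> 0"
    using w by auto
  ultimately show ?case
    by (simp add: field_simps)
next
  case (Suc m)
  have "of_nat (Suc m) * (LINT s:{0<..}|lborel. of_real s ^ m * exp (- w * of_real s))
      - w * (LINT s:{0<..}|lborel. of_real s ^ Suc m * exp (- w * of_real s))
    = (LINT s:{0<..}|lborel. of_nat (Suc m) * (of_real s ^ m * exp (- w * of_real s))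
      - w * (of_real s ^ Suc m * exp (- w * of_real s)))"
    by (simp only: set_integral_diff set_integral_mult_right set_integrable_mult_right
        integrable_power_exp[OF w])
  also have "\<dots> = 0"
    using integral_deriv_power_exp[OF w, of "Suc m"] by simp
  finally have "w * (LINT s:{0<..}|lborel. of_real s ^ Suc m * exp (- w * of_real s))
      = fact (Suc m) / w ^ Suc m"
    unfolding Suc.IH by simp
  moreover have "w \<noteq> 0"
    using w by auto
  ultimately show ?case
    by (simp add: field_simps)
qed

section \<open>The ambiguity function\<close>

text \<open>
  The variable \<open>s\<close> measures the distance from the left end \<open>\<bar>x\<bar> / 2\<close> of the support. Then
  \<open>t + x / 2\<close> and \<open>t - x / 2\<close> are \<open>s\<close> and \<open>s + \<bar>x\<bar>\<close>, in an order that depends on the sign of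
  \<open>x\<close>; only the unordered pair matters, so the sign of \<open>x\<close> drops out.
\<close>
lemma ambiguity_f_fun_integrand:
  fixes x \<xi> s :: real and n :: nat
  defines "w \<equiv> 2 + 2 * of_real pi * \<i> * of_real \<xi>" and "t \<equiv> \<bar>x\<bar> / 2 + s"
  shows "f_fun n (t + x / 2) * cnj (f_fun n (t - x / 2)) *
        exp (- 2 * of_real pi * \<i> * of_real \<xi> * of_real t)
    = exp (- (of_real \<bar>x\<bar> * w / 2)) * indicator {0<..} s *\<^sub>R
        ((of_real s * of_real (s + \<bar>x\<bar>)) ^ n * exp (- w * of_real s))"
proof (cases "0 < s")
  case True
  have "f_fun n (t + x / 2) * cnj (f_fun n (t - x / 2))
      = of_real (((t + x / 2) * (t - x / 2)) ^ n * (exp (- (t + x / 2)) * exp (- (t - x / 2))))"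
    using True by (auto simp: f_fun_def t_def indicator_def power_mult_distrib)
  also have "(t + x / 2) * (t - x / 2) = s * (s + \<bar>x\<bar>)"
    by (cases "0 \<le> x") (simp_all add: t_def algebra_simps)
  also have "exp (- (t + x / 2)) * exp (- (t - x / 2)) = exp (- (2 * t))"
    by (simp flip: exp_add)
  finally have "f_fun n (t + x / 2) * cnj (f_fun n (t - x / 2)) *
        exp (- 2 * of_real pi * \<i> * of_real \<xi> * of_real t)
      = (of_real s * of_real (s + \<bar>x\<bar>)) ^ n * (exp (- (2 * of_real t))
        * exp (- 2 * of_real pi * \<i> * of_real \<xi> * of_real t))"
    by (simp add: mult.assoc flip: exp_of_real)
  also have "exp (- (2 * of_real t)) * exp (- 2 * of_real pi * \<i> * of_real \<xi> * of_real t)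
      = exp (- (of_real \<bar>x\<bar> * w / 2)) * exp (- w * of_real s)"
    unfolding exp_add[symmetric] w_def t_def
    by (intro arg_cong[where f = exp]) (simp add: field_simps)
  finally show ?thesis
    using True by simp
next
  case False
  then have "\<not> (0 < t + x / 2 \<and> 0 < t - x / 2)"
    by (auto simp: t_def)
  then show ?thesis
    using False by (auto simp: f_fun_def)
qed

lemma ambiguity_f_fun:
  fixes x \<xi> :: real and n :: nat
  defines "w \<equiv> 2 + 2 * of_real pi * \<i> * of_real \<xi>"
  shows "ambiguity (f_fun n) (f_fun n) (x, \<xi>)
    = exp (- (of_real \<bar>x\<bar> * w / 2)) / w ^ (2 * n + 1) * poly (A_poly n) (of_real \<bar>x\<bar> * w)"
proof -
  define a where "a = complex_of_real \<bar>x\<bar>"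
  define E where "E = exp (- (a * w / 2))"
  define g where "g t = f_fun n (t + x / 2) * cnj (f_fun n (t - x / 2)) *
        exp (- 2 * of_real pi * \<i> * of_real \<xi> * of_real t)" for t
  define h where "h k s = of_real s ^ (n + k) * exp (- w * of_real s)" for k :: nat and s :: real
  have w: "0 < Re w"
    by (simp add: w_def)
  then have "w \<noteq> 0" by auto
  have h_integrable: "set_integrable lborel {0<..} (h k)" for k
    unfolding h_def by (rule integrable_power_exp[OF w])
  have expand: "(of_real s * of_real (s + \<bar>x\<bar>)) ^ n * exp (- w * of_real s)
      = (\<Sum>k\<le>n. of_nat (n choose k) * a ^ (n - k) * h k s)" for s
    by (simp add: power_mult_distrib binomial_ring sum_distrib_left sum_distrib_right h_def a_def
        power_add ac_simps)
  have "g \<in> borel_measurable lborel"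
    unfolding g_def f_fun_def complex_cnj_complex_of_real by measurable
  then have "ambiguity (f_fun n) (f_fun n) (x, \<xi>) = (LINT t|lborel. g t)"
    unfolding ambiguity_def g_def by (simp add: integral_completion)
  also have "\<dots> = (LINT s|lborel. g (\<bar>x\<bar> / 2 + s))"
    using lborel_integral_real_affine[of 1 g "\<bar>x\<bar> / 2"] by simp
  also have "\<dots> = (LINT s|lborel. E * indicator {0<..} s *\<^sub>R
      (\<Sum>k\<le>n. of_nat (n choose k) * a ^ (n - k) * h k s))"
    unfolding g_def ambiguity_f_fun_integrand expand[symmetric] unfolding E_def a_def w_def ..
  also have "\<dots> = E * (LINT s:{0<..}|lborel. \<Sum>k\<le>n. of_nat (n choose k) * a ^ (n - k) * h k s)"
    unfolding set_lebesgue_integral_def by (rule integral_mult_right_zero)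
  also have "(LINT s:{0<..}|lborel. \<Sum>k\<le>n. of_nat (n choose k) * a ^ (n - k) * h k s)
      = (\<Sum>k\<le>n. LINT s:{0<..}|lborel. of_nat (n choose k) * a ^ (n - k) * h k s)"
    unfolding set_lebesgue_integral_def scaleR_sum_right
    by (intro Bochner_Integration.integral_sum)
      (use h_integrable in \<open>simp flip: set_integrable_def\<close>)
  also have "\<dots> = (\<Sum>k\<le>n. of_nat (n choose k) * a ^ (n - k) * (fact (n + k) / w ^ Suc (n + k)))"
    unfolding set_integral_mult_right h_def laplace_transform_power[OF w] ..
  also have "\<dots> = (\<Sum>k\<le>n. of_nat ((n choose k) * fact (n + k)) * (a * w) ^ (n - k)) / w ^ (2 * n + 1)"
    unfolding sum_divide_distrib
  proof (intro sum.cong refl)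
    fix k assume "k \<in> {..n}"
    then have "w ^ (2 * n + 1) = w ^ (n - k) * w ^ Suc (n + k)"
      unfolding power_add[symmetric] by (simp add: mult_2)
    then show "of_nat (n choose k) * a ^ (n - k) * (fact (n + k) / w ^ Suc (n + k))
        = of_nat ((n choose k) * fact (n + k)) * (a * w) ^ (n - k) / w ^ (2 * n + 1)"
      using \<open>w \<noteq> 0\<close> by (simp add: power_mult_distrib)
  qed
  finally show ?thesis
    unfolding poly_A_poly[symmetric] E_def a_def by simp
qed

theorem theorem4p2:
  fixes n :: nat
  shows "hurwitz_polynomial (A_poly n) \<and>
         (\<forall>x \<xi> :: real. ambiguity (f_fun n) (f_fun n) (x, \<xi>) \<noteq> 0)"
proof (intro conjI allI)
  show "hurwitz_polynomial (A_poly n)"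
    unfolding hurwitz_polynomial_def using A_poly_nonzero not_less by blast
next
  fix x \<xi> :: real
  have "2 + 2 * of_real pi * \<i> * of_real \<xi> \<noteq> (0 :: complex)"
    by (simp add: complex_eq_iff)
  moreover have "poly (A_poly n) (of_real \<bar>x\<bar> * (2 + 2 * of_real pi * \<i> * of_real \<xi>)) \<noteq> 0"
    by (rule A_poly_nonzero) simp
  ultimately show "ambiguity (f_fun n) (f_fun n) (x, \<xi>) \<noteq> 0"
    unfolding ambiguity_f_fun by simp
qed

end
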